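(* There exist absolute constants $c,C>0$ such that for every allocation process satisfying Condition $\mathcal{P}$ and Condition $\mathcal{W}$ and every round $m\ge 2$, the throughput satisfies $\mathbb{E}[\mu^m]\ge 1+c$. Moreover, if additionally the probability vector $p^t$ is the uniform vector $(1/n,\dots,1/n)$ in every round, then for every $m\ge 2$, $1+c\le \mathbb{E}[\mu^m]\le C$.
   Context: There are $n$ bins. An allocation process proceeds in rounds $t=0,1,2,\dots$; $x^t\in\mathbb{Z}_{\ge 0}^n$ is the load vector after $t$ rounds, $x^0=(0,\dots,0)$; in each round every load increases by a non-negative integer and at least one ball is allocated. $W^t=\sum_i x_i^t$, $y_i^t=x_i^t-W^t/n$, $B_-^t=\{i:y_i^t<0\}$. $\mathfrak{F}^t$ is the history of the first $t$ rounds. The throughput at round $t\ge1$ is $\mu^t=W^t/t$. Condition $\mathcal{P}$: in each round $t$, label the bins so that $y_1^t\ge\cdots\ge y_n^t$; a bin $i=i^t$ is sampled according to a probability vector $p^t$ (possibly depending on $\mathfrak{F}^t$) with $\sum_{j=1}^k p_j^t\le k/n$ for all $k\in[n]$. Condition $\mathcal{W}$: with $i$ the sampled bin: if $y_i^t\ge0$, one ball is allocated to $i$; if $y_i^t<0$, exactly $\lceil -y_i^t\rceil+1$ balls are allocated to bins of $B_-^t$ such that at most one bin $k_1\in B_-^t$ receives $\lceil -y_{k_1}^t\rceil+1$ balls, at most one bin $k_2\in B_-^t$ receives $\lceil -y_{k_2}^t\rceil$ balls, and every other $j\in B_-^t$ receives at most $\lceil -y_j^t\rceil-1$ balls. Convention: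 statements are asserted for all sufficiently large $n$. *)

theory Defs
  imports "HOL-Probability.Probability"
begin

text \<open>
  Bins are \<open>{1..n}\<close>. The outcome of a round is the sampled bin together with the number of balls
  that each bin receives; a history lists the outcomes of the completed rounds, oldest first, so
  its length is the current round index \<open>t\<close>. Entries outside \<open>{1..n}\<close> of the received-balls function are
  unconstrained and never counted.

  An allocation process is given by its transition law \<open>K\<close>: after the history \<open>h\<close>, the next
  outcome has law \<open>K h\<close>. Thus both the sampling vector and the choice of where the balls go may
  depend on the whole history, the latter also on the sampled bin and on further randomness.
\<close>

type_synonym outcome = "nat \<times> (nat \<Rightarrow> nat)"
type_synonym history = "outcome list"
type_synonym transition = "history \<Rightarrow> outcome pmf"

fun history_pmf :: "transition \<Rightarrow> nat \<Rightarrow> history pmf" where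
  "history_pmf K 0 = return_pmf []"
| "history_pmf K (Suc t) = bind_pmf (history_pmf K t) (\<lambda>h. map_pmf (\<lambda>r. h @ [r]) (K h))"

definition reachable :: "transition \<Rightarrow> history \<Rightarrow> bool" where
  "reachable K h \<longleftrightarrow> (\<exists>t. h \<in> set_pmf (history_pmf K t))"

definition load :: "history \<Rightarrow> nat \<Rightarrow> nat" where
  "load h j = (\<Sum>r\<leftarrow>h. snd r j)"

definition total_load :: "nat \<Rightarrow> history \<Rightarrow> nat" where
  "total_load n h = (\<Sum>j\<in>{1..n}. load h j)"

definition norm_load :: "nat \<Rightarrow> history \<Rightarrow> nat \<Rightarrow> real" where
  "norm_load n h j = real (load h j) - real (total_load n h) / real n"

definition underloaded :: "nat \<Rightarrow> history \<Rightarrow> nat set" where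
  "underloaded n h = {j \<in> {1..n}. norm_load n h j < 0}"

definition allocation_process :: "nat \<Rightarrow> transition \<Rightarrow> bool" where
  "allocation_process n K \<longleftrightarrow>
     (\<forall>h. reachable K h \<longrightarrow> (\<forall>(i, a) \<in> set_pmf (K h). i \<in> {1..n} \<and> (\<Sum>j\<in>{1..n}. a j) \<ge> 1))"

text \<open>
  \<open>p h j\<close> is the probability, given the history \<open>h\<close>, of sampling the bin with label \<open>j\<close>, i.e. the
  bin \<open>\<sigma> j\<close>, where \<open>\<sigma>\<close> orders the bins by non-increasing load with ties broken arbitrarily.
\<close>

definition condition_P :: "nat \<Rightarrow> transition \<Rightarrow> (history \<Rightarrow> nat \<Rightarrow> real) \<Rightarrow> bool" where
  "condition_P n K p \<longleftrightarrow>
     (\<forall>h. reachable K h \<longrightarrow>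
        (\<forall>j\<in>{1..n}. p h j \<ge> 0) \<and> (\<Sum>j\<in>{1..n}. p h j) = 1 \<and>
        (\<forall>k\<in>{1..n}. (\<Sum>j\<in>{1..k}. p h j) \<le> real k / real n) \<and>
        (\<exists>\<sigma>. bij_betw \<sigma> {1..n} {1..n} \<and>
             (\<forall>j\<in>{1..n}. \<forall>k\<in>{1..n}. j \<le> k \<longrightarrow> norm_load n h (\<sigma> j) \<ge> norm_load n h (\<sigma> k)) \<and>
             (\<forall>j\<in>{1..n}. pmf (map_pmf fst (K h)) (\<sigma> j) = p h j)))"

definition condition_W :: "nat \<Rightarrow> transition \<Rightarrow> bool" where
  "condition_W n K \<longleftrightarrow>
     (\<forall>h. reachable K h \<longrightarrow> (\<forall>(i, a) \<in> set_pmf (K h).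
        (norm_load n h i \<ge> 0 \<longrightarrow> (\<forall>j\<in>{1..n}. a j = (if j = i then 1 else 0))) \<and>
        (norm_load n h i < 0 \<longrightarrow>
           (let B = underloaded n h; d = (\<lambda>j. \<lceil>- norm_load n h j\<rceil>) in
              (\<forall>j\<in>{1..n} - B. a j = 0) \<and>
              (\<Sum>j\<in>B. int (a j)) = d i + 1 \<and>
              card {j \<in> B. int (a j) = d j + 1} \<le> 1 \<and>
              card {j \<in> B. int (a j) = d j} \<le> 1 \<and>
              (\<forall>j\<in>B. int (a j) = d j + 1 \<or> int (a j) = d j \<or> int (a j) \<le> d j - 1)))))"

definition uniform_sampling :: "nat \<Rightarrow> transition \<Rightarrow> (history \<Rightarrow> nat \<Rightarrow> real) \<Rightarrow> bool" where
  "uniform_sampling n K p \<longleftrightarrow> (\<forall>h. reachable K h \<longrightarrow> (\<forall>j\<in>{1..n}. p h j = 1 / real n))"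

definition expected_throughput :: "nat \<Rightarrow> transition \<Rightarrow> nat \<Rightarrow> real" where
  "expected_throughput n K m =
     measure_pmf.expectation (history_pmf K m) (\<lambda>h. real (total_load n h) / real m)"

end

theory Submission
  imports Defs
begin

text \<open>
  A round sampling bin \<open>i\<close> allocates \<open>1 + d\<^sub>i\<close> balls, where \<open>d\<^sub>i = \<lceil>-y\<^sub>i\<rceil>\<close> if \<open>y\<^sub>i < 0\<close> and \<open>d\<^sub>i = 0\<close> otherwise.

  Lower bound: loads are integers, so if the fractional part of \<open>W/n\<close> lies in \<open>(0, 3/4]\<close>, every bin with
  \<open>y \<ge> 0\<close> has \<open>y \<ge> 1/4\<close>; as the \<open>y\<^sub>i\<close> sum to zero, this forces \<open>\<Sum>d\<^sub>i \<ge> n/8\<close>, and Condition P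
  gives at least \<open>9/8\<close> balls in expectation. The remaining rounds have distinct values of \<open>W\<close> in a set
  of density about \<open>1/4\<close>, so adding \<open>1/8\<close> of the number of such values below \<open>W\<close> to \<open>W\<close> yields a process
  with drift at least \<open>9/8\<close> in every round.

  Upper bound: let \<open>\<Phi>\<close> be the sum of the squared positive parts of the \<open>y\<^sub>i\<close>, and \<open>S\<close> the sum of these
  positive parts, which is also the sum of the negative parts. Filling underloaded bins costs at most 5
  in \<open>\<Phi>\<close>, and the growth of the average by \<open>b/n\<close> lowers \<open>\<Phi>\<close> by \<open>2Sb/n\<close> up to an error \<open>b\<^sup>2/n\<close>. Under
  uniform sampling the error averages to about \<open>(S/n)\<^sup>2\<close>, half of the quadratic part of the gain, so
  \<open>\<Phi>\<close> has drift at most \<open>O(1) - S/n\<close>, which pays for the expected number of balls, at most \<open>2 + S/n\<close>.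
\<close>

section \<open>Integrals over discrete distributions and additive drift\<close>

lemma integrable_measure_pmf_bounded:
  fixes f :: "'a \<Rightarrow> real"
  assumes "\<And>x. x \<in> set_pmf M \<Longrightarrow> \<bar>f x\<bar> \<le> B"
  shows "integrable (measure_pmf M) f"
  using assms by (intro measure_pmf.integrable_const_bound[where B = B]) (auto simp: AE_measure_pmf_iff)

lemma integral_bind_pmf_bounded:
  fixes f :: "'b \<Rightarrow> real"
  assumes "\<And>y. y \<in> set_pmf (bind_pmf M N) \<Longrightarrow> \<bar>f y\<bar> \<le> B"
  shows "(\<integral>y. f y \<partial>measure_pmf (bind_pmf M N)) = (\<integral>x. \<integral>y. f y \<partial>measure_pmf (N x) \<partial>measure_pmf M)"
proof -
  \<comment> \<open>Cutting \<open>f\<close> off outside the support turns the bound on the support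
    into a global one, which \<open>integral_bind\<close> asks for.\<close>
  define g where "g y = (if y \<in> set_pmf (bind_pmf M N) then f y else 0)" for y
  have "set_pmf (bind_pmf M N) \<noteq> {}" by (rule set_pmf_not_empty)
  with assms have "0 \<le> B" by (meson abs_ge_zero ex_in_conv order_trans)
  then have bound: "norm (g y) \<le> B" for y
    using assms by (simp add: g_def)
  have "(\<integral>y. f y \<partial>measure_pmf (bind_pmf M N)) = (\<integral>y. g y \<partial>measure_pmf (bind_pmf M N))"
    by (intro integral_cong_AE) (auto simp: AE_measure_pmf_iff g_def)
  also have "\<dots> = (\<integral>x. \<integral>y. g y \<partial>measure_pmf (N x) \<partial>measure_pmf M)"
    unfolding measure_pmf_bind using bound measurable_measure_pmf[of N]
    by (intro integral_bind[where K = "count_space UNIV" and B = B and B' = 1])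
       (auto simp: measure_pmf.emeasure_space_1 intro: measure_pmf.finite_measure)
  also have "\<dots> = (\<integral>x. \<integral>y. f y \<partial>measure_pmf (N x) \<partial>measure_pmf M)"
    by (intro integral_cong_AE) (auto simp: AE_measure_pmf_iff g_def intro!: integral_cong_AE)
  finally show ?thesis .
qed

lemma set_pmf_history_Suc:
  "set_pmf (history_pmf K (Suc t)) = {h @ [r] |h r. h \<in> set_pmf (history_pmf K t) \<and> r \<in> set_pmf (K h)}"
  by auto

lemma integrable_next_outcome:
  fixes f :: "history \<Rightarrow> real"
  assumes bound: "\<And>t. \<exists>B. \<forall>h\<in>set_pmf (history_pmf K t). \<bar>f h\<bar> \<le> B"
    and "reachable K h"
  shows "integrable (measure_pmf (K h)) (\<lambda>r. f (h @ [r]))"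
proof -
  obtain t where t: "h \<in> set_pmf (history_pmf K t)"
    using assms(2) unfolding reachable_def by blast
  obtain B where B: "\<And>h. h \<in> set_pmf (history_pmf K (Suc t)) \<Longrightarrow> \<bar>f h\<bar> \<le> B"
    using bound by blast
  show ?thesis
    using t by (intro integrable_measure_pmf_bounded[where B = B] B) auto
qed

text \<open>Conditioning on the first \<open>t\<close> rounds and induction on \<open>t\<close>. The
  bound on \<open>f\<close> may grow with the round: it only secures integrability and the splitting
  of the expectation.\<close>

lemma expectation_drift_ge:
  fixes f :: "history \<Rightarrow> real"
  assumes bound: "\<And>t. \<exists>B. \<forall>h\<in>set_pmf (history_pmf K t). \<bar>f h\<bar> \<le> B"
    and drift: "\<And>h. reachable K h \<Longrightarrow> f h + a \<le> (\<integral>r. f (h @ [r]) \<partial>measure_pmf (K h))"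
  shows "f [] + real t * a \<le> (\<integral>h. f h \<partial>measure_pmf (history_pmf K t))"
proof (induction t)
  case 0
  then show ?case by simp
next
  case (Suc t)
  obtain B where B: "\<And>h. h \<in> set_pmf (history_pmf K t) \<Longrightarrow> \<bar>f h\<bar> \<le> B"
    using bound by blast
  obtain B' where B': "\<And>h. h \<in> set_pmf (history_pmf K (Suc t)) \<Longrightarrow> \<bar>f h\<bar> \<le> B'"
    using bound by blast
  let ?g = "\<lambda>h. \<integral>r. f (h @ [r]) \<partial>measure_pmf (K h)"
  have step: "\<bar>f (h @ [r])\<bar> \<le> B'" if "h \<in> set_pmf (history_pmf K t)" "r \<in> set_pmf (K h)" for h r
    using that by (intro B') auto
  have gB: "\<bar>?g h\<bar> \<le> B'" if h: "h \<in> set_pmf (history_pmf K t)" for h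
  proof -
    have i: "integrable (measure_pmf (K h)) (\<lambda>r. f (h @ [r]))"
      using bound by (rule integrable_next_outcome) (use h in \<open>auto simp: reachable_def\<close>)
    have "?g h \<le> B'"
      using step[OF h] by (intro measure_pmf.integral_le_const i AE_pmfI) (fastforce simp: abs_le_iff)
    moreover have "- B' \<le> ?g h"
      using step[OF h] by (intro measure_pmf.integral_ge_const i AE_pmfI) (fastforce simp: abs_le_iff)
    ultimately show ?thesis by simp
  qed
  have int_f: "integrable (measure_pmf (history_pmf K t)) f"
    using B by (rule integrable_measure_pmf_bounded)
  have "f [] + real (Suc t) * a \<le> (\<integral>h. f h + a \<partial>measure_pmf (history_pmf K t))"
    using Suc.IH by (simp add: int_f distrib_right)
  also have "\<dots> \<le> (\<integral>h. ?g h \<partial>measure_pmf (history_pmf K t))"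
  proof (rule integral_mono_AE)
    show "AE h in measure_pmf (history_pmf K t). f h + a \<le> ?g h"
      by (intro AE_pmfI drift) (auto simp: reachable_def)
    show "integrable (measure_pmf (history_pmf K t)) (\<lambda>h. f h + a)"
      using int_f by simp
  qed (rule integrable_measure_pmf_bounded[OF gB])
  also have "\<dots> = (\<integral>h. f h \<partial>measure_pmf (history_pmf K (Suc t)))"
    using integral_bind_pmf_bounded[of "history_pmf K t" "\<lambda>h. map_pmf (\<lambda>r. h @ [r]) (K h)" f B'] B'
    by simp
  finally show ?case .
qed

lemma expectation_drift_le:
  fixes f :: "history \<Rightarrow> real"
  assumes "\<And>t. \<exists>B. \<forall>h\<in>set_pmf (history_pmf K t). \<bar>f h\<bar> \<le> B"
    and "\<And>h. reachable K h \<Longrightarrow> (\<integral>r. f (h @ [r]) \<partial>measure_pmf (K h)) \<le> f h + a"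
  shows "(\<integral>h. f h \<partial>measure_pmf (history_pmf K t)) \<le> f [] + real t * a"
proof -
  have "- f [] + real t * (- a) \<le> (\<integral>h. - f h \<partial>measure_pmf (history_pmf K t))"
  proof (rule expectation_drift_ge)
    show "- f h + - a \<le> (\<integral>r. - f (h @ [r]) \<partial>measure_pmf (K h))" if "reachable K h" for h
      using assms(2)[OF that] by simp
  qed (use assms(1) in simp)
  then show ?thesis by simp
qed

section \<open>Number of balls per round and crude bounds\<close>

definition deficit :: "nat \<Rightarrow> history \<Rightarrow> nat \<Rightarrow> real" where
  "deficit n h j = (if norm_load n h j < 0 then of_int \<lceil>- norm_load n h j\<rceil> else 0)"

lemma deficit_nonneg: "0 \<le> deficit n h j"
  by (simp add: deficit_def)

lemma total_load_Nil [simp]: "total_load n [] = 0"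
  by (simp add: total_load_def load_def)

lemma norm_load_Nil [simp]: "norm_load n [] j = 0"
  by (simp add: norm_load_def load_def)

lemma load_append: "load (h @ [r]) j = load h j + snd r j"
  by (simp add: load_def)

lemma total_load_append: "total_load n (h @ [r]) = total_load n h + (\<Sum>j\<in>{1..n}. snd r j)"
  by (simp add: total_load_def load_append sum.distrib)

lemma sum_norm_load:
  assumes "n > 0"
  shows "(\<Sum>j\<in>{1..n}. norm_load n h j) = 0"
  using assms by (simp add: norm_load_def sum_subtractf total_load_def)

lemma sum_norm_load_pos_part:
  assumes "n > 0"
  shows "(\<Sum>j\<in>{1..n}. max 0 (norm_load n h j)) = (\<Sum>j\<in>{1..n}. max 0 (- norm_load n h j))"
proof -
  have "(\<Sum>j\<in>{1..n}. max 0 (norm_load n h j)) - (\<Sum>j\<in>{1..n}. max 0 (- norm_load n h j))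
      = (\<Sum>j\<in>{1..n}. norm_load n h j)"
    unfolding sum_subtractf[symmetric] by (intro sum.cong) auto
  then show ?thesis using sum_norm_load[OF assms] by simp
qed

lemma deficit_ge: "max 0 (- norm_load n h j) \<le> deficit n h j"
  by (auto simp: deficit_def)

lemma deficit_le: "deficit n h j \<le> max 0 (- norm_load n h j) + 1"
  unfolding deficit_def by (auto intro: less_imp_le) linarith+

text \<open>Where the balls land does not matter here: their number depends on the sampled bin
  alone, so its expectation over a round becomes a finite sum over bins.\<close>

lemma condition_W_balls:
  assumes W: "condition_W n K" and A: "allocation_process n K"
    and h: "reachable K h" and r: "r \<in> set_pmf (K h)"
  shows "real (\<Sum>j\<in>{1..n}. snd r j) = 1 + deficit n h (fst r)"
proof -
  obtain i a where ia: "r = (i, a)" by force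
  have i: "i \<in> {1..n}" using A h r unfolding allocation_process_def ia by fastforce
  note W' = W[unfolded condition_W_def, rule_format, OF h r[unfolded ia], unfolded case_prod_conv Let_def]
  show ?thesis
  proof (cases "norm_load n h i \<ge> 0")
    case True
    with W' have "\<And>j. j \<in> {1..n} \<Longrightarrow> a j = (if j = i then 1 else 0)" by blast
    then have "(\<Sum>j\<in>{1..n}. a j) = (\<Sum>j\<in>{1..n}. if j = i then 1 else 0)" by (rule sum.cong[OF refl])
    then show ?thesis using True i by (simp add: ia deficit_def)
  next
    case False
    with W' have 0: "\<forall>j\<in>{1..n} - underloaded n h. a j = 0"
      and s: "(\<Sum>j\<in>underloaded n h. int (a j)) = \<lceil>- norm_load n h i\<rceil> + 1" by auto
    have "(\<Sum>j\<in>{1..n}. a j) = (\<Sum>j\<in>underloaded n h. a j)"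
      using 0 by (intro sum.mono_neutral_right) (auto simp: underloaded_def)
    then have "int (\<Sum>j\<in>{1..n}. a j) = \<lceil>- norm_load n h i\<rceil> + 1" using s by simp
    then have "real_of_int (int (\<Sum>j\<in>{1..n}. a j)) = real_of_int (\<lceil>- norm_load n h i\<rceil> + 1)" by (rule arg_cong)
    then show ?thesis using False by (simp add: ia deficit_def)
  qed
qed

lemma deficit_le_total_load:
  assumes "n > 0"
  shows "deficit n h j \<le> real (total_load n h)"
proof -
  have "- norm_load n h j \<le> real (total_load n h) / real n" by (simp add: norm_load_def)
  also have "\<dots> \<le> real (total_load n h) / 1"
    using assms by (intro divide_left_mono) auto
  finally have "- norm_load n h j \<le> real_of_int (int (total_load n h))" by simp
  then have "\<lceil>- norm_load n h j\<rceil> \<le> int (total_load n h)" by (rule ceiling_le)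
  then show ?thesis by (auto simp: deficit_def)
qed

text \<open>A deficit is at most the current total, so a round at most doubles the total and adds
  one. This supplies the boundedness that the drift lemmas require.\<close>

lemma total_load_bounded:
  assumes "condition_W n K" "allocation_process n K" "n > 0"
  shows "\<exists>B\<ge>0. \<forall>h\<in>set_pmf (history_pmf K t). real (total_load n h) \<le> B"
proof (induction t)
  case 0
  then show ?case by auto
next
  case (Suc t)
  then obtain B where B: "B \<ge> 0" "\<And>h. h \<in> set_pmf (history_pmf K t) \<Longrightarrow> real (total_load n h) \<le> B"
    by blast
  have "real (total_load n (h @ [r])) \<le> 2 * B + 1"
    if h: "h \<in> set_pmf (history_pmf K t)" and r: "r \<in> set_pmf (K h)" for h r
    using condition_W_balls[OF assms(1,2) _ r] h deficit_le_total_load[OF assms(3), of h "fst r"] B(2)[OF h]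
    by (simp add: total_load_append reachable_def) fastforce
  then show ?case using B(1) unfolding set_pmf_history_Suc by (intro exI[of _ "2 * B + 1"]) auto
qed

lemma expectation_sampled_bin:
  fixes v :: "nat \<Rightarrow> real"
  assumes "allocation_process n K" "reachable K h"
  shows "(\<integral>r. v (fst r) \<partial>measure_pmf (K h)) = (\<Sum>i\<in>{1..n}. pmf (map_pmf fst (K h)) i * v i)"
proof -
  have "(\<integral>r. v (fst r) \<partial>measure_pmf (K h)) = (\<integral>i. v i \<partial>measure_pmf (map_pmf fst (K h)))" by simp
  also have "\<dots> = (\<Sum>i\<in>{1..n}. v i * pmf (map_pmf fst (K h)) i)"
    using assms unfolding allocation_process_def
    by (intro integral_measure_pmf_real) fastforce+
  finally show ?thesis by (simp add: mult.commute)
qed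

lemma integrable_sampled_bin:
  fixes v :: "nat \<Rightarrow> real"
  assumes "allocation_process n K" "reachable K h"
  shows "integrable (measure_pmf (K h)) (\<lambda>r. v (fst r))"
proof (rule integrable_measure_pmf_bounded)
  fix r assume "r \<in> set_pmf (K h)"
  then have "fst r \<in> {1..n}" using assms unfolding allocation_process_def by fastforce
  then show "\<bar>v (fst r)\<bar> \<le> (\<Sum>i\<in>{1..n}. \<bar>v i\<bar>)" by (intro member_le_sum) auto
qed


section \<open>Condition P as a majorization inequality\<close>

lemma abel_prefix_nonpos:
  fixes q g :: "nat \<Rightarrow> real"
  assumes "n \<ge> 1"
    and prefix: "\<And>k. k \<in> {1..n} \<Longrightarrow> (\<Sum>j\<in>{1..k}. q j) \<le> 0"
    and total: "(\<Sum>j\<in>{1..n}. q j) = 0"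
    and mono: "\<And>j. 1 \<le> j \<Longrightarrow> Suc j \<le> n \<Longrightarrow> g j \<le> g (Suc j)"
  shows "0 \<le> (\<Sum>j\<in>{1..n}. q j * g j)"
proof -
  \<comment> \<open>Summation by parts as an induction: the boundary term on the left only decreases
    from \<open>g k\<close> to \<open>g (Suc k)\<close>, because the prefix sum is nonpositive. At
    \<open>k = n\<close> it vanishes.\<close>
  have "(\<Sum>j\<in>{1..k}. q j) * g k \<le> (\<Sum>j\<in>{1..k}. q j * g j)" if "1 \<le> k" "k \<le> n" for k
    using that
  proof (induction k rule: nat_induct_at_least)
    case base
    then show ?case by simp
  next
    case (Suc k)
    have "(\<Sum>j\<in>{1..k}. q j) * g (Suc k) \<le> (\<Sum>j\<in>{1..k}. q j) * g k"
      using Suc prefix[of k] mono[of k] by (intro mult_left_mono_neg) auto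
    also have "\<dots> \<le> (\<Sum>j\<in>{1..k}. q j * g j)"
      using Suc by simp
    finally show ?case by (simp add: distrib_right)
  qed
  from this[of n] show ?thesis using assms(1) total by simp
qed

lemma deficit_antimono:
  assumes "norm_load n h k \<le> norm_load n h j"
  shows "deficit n h j \<le> deficit n h k"
  using assms by (auto simp: deficit_def intro!: ceiling_mono)

text \<open>Deficits increase along the labelling, towards which Condition P shifts mass compared
  with uniform sampling. Summation by parts applies to the differences
  \<open>p h j - 1 / real n\<close>.\<close>

lemma condition_P_expected_deficit:
  assumes P: "condition_P n K p" and h: "reachable K h" and n: "n \<ge> 1"
  shows "(\<Sum>i\<in>{1..n}. deficit n h i) / real n
      \<le> (\<Sum>i\<in>{1..n}. pmf (map_pmf fst (K h)) i * deficit n h i)"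
proof -
  let ?P = "pmf (map_pmf fst (K h))" and ?D = "deficit n h"
  note P' = P[unfolded condition_P_def, rule_format, OF h]
  then have total: "(\<Sum>j\<in>{1..n}. p h j) = 1"
    and prefix: "\<And>k. k \<in> {1..n} \<Longrightarrow> (\<Sum>j\<in>{1..k}. p h j) \<le> real k / real n" by blast+
  from P' have "\<exists>\<sigma>. bij_betw \<sigma> {1..n} {1..n} \<and>
      (\<forall>j\<in>{1..n}. \<forall>k\<in>{1..n}. j \<le> k \<longrightarrow> norm_load n h (\<sigma> k) \<le> norm_load n h (\<sigma> j)) \<and>
      (\<forall>j\<in>{1..n}. ?P (\<sigma> j) = p h j)" by (elim conjE)
  then obtain \<sigma> where \<sigma>: "bij_betw \<sigma> {1..n} {1..n}"
    and sorted: "\<And>j k. j \<in> {1..n} \<Longrightarrow> k \<in> {1..n} \<Longrightarrow> j \<le> k \<Longrightarrow> norm_load n h (\<sigma> k) \<le> norm_load n h (\<sigma> j)"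
    and p: "\<And>j. j \<in> {1..n} \<Longrightarrow> ?P (\<sigma> j) = p h j"
    by metis
  have "0 \<le> (\<Sum>j\<in>{1..n}. (p h j - 1 / real n) * ?D (\<sigma> j))"
    using n total prefix
    by (intro abel_prefix_nonpos) (auto simp: sum_subtractf intro!: deficit_antimono sorted)
  also have "\<dots> = (\<Sum>j\<in>{1..n}. ?P (\<sigma> j) * ?D (\<sigma> j)) - (\<Sum>j\<in>{1..n}. ?D (\<sigma> j)) / real n"
    by (simp add: p left_diff_distrib sum_subtractf sum_divide_distrib)
  also have "(\<Sum>j\<in>{1..n}. ?P (\<sigma> j) * ?D (\<sigma> j)) = (\<Sum>i\<in>{1..n}. ?P i * ?D i)"
    by (rule sum.reindex_bij_betw[OF \<sigma>])
  also have "(\<Sum>j\<in>{1..n}. ?D (\<sigma> j)) = (\<Sum>i\<in>{1..n}. ?D i)"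
    by (rule sum.reindex_bij_betw[OF \<sigma>])
  finally show ?thesis by simp
qed

lemma uniform_sampling_pmf:
  assumes "condition_P n K p" "uniform_sampling n K p" "reachable K h" "i \<in> {1..n}"
  shows "pmf (map_pmf fst (K h)) i = 1 / real n"
proof -
  from assms obtain \<sigma> where \<sigma>: "bij_betw \<sigma> {1..n} {1..n}"
    and p: "\<forall>j\<in>{1..n}. pmf (map_pmf fst (K h)) (\<sigma> j) = p h j"
    unfolding condition_P_def by blast
  obtain j where "j \<in> {1..n}" "i = \<sigma> j"
    using \<sigma> assms(4) unfolding bij_betw_def by blast
  with p assms(2,3) show ?thesis unfolding uniform_sampling_def by metis
qed

section \<open>Lower bound on the expected total load\<close>

lemma sum_deficit_ge:
  assumes n: "n > 0" and r: "0 < total_load n h mod n" "4 * (total_load n h mod n) \<le> 3 * n"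
  shows "real n / 8 \<le> (\<Sum>j\<in>{1..n}. deficit n h j)"
proof -
  let ?W = "total_load n h"
  \<comment> \<open>Summed over the bins, the positive parts equal the negative parts, which the
    deficits dominate. So \<open>1 / 4\<close> per bin gives \<open>n / 4\<close> against twice the
    total deficit.\<close>
  have pt: "1 / 4 \<le> max 0 (norm_load n h j) + deficit n h j" for j
  proof (cases "norm_load n h j < 0")
    case True
    then have "1 \<le> \<lceil>- norm_load n h j\<rceil>" by simp
    then have "1 \<le> deficit n h j" using True by (simp add: deficit_def)
    then show ?thesis by simp
  next
    case False
    \<comment> \<open>The average \<open>W / n\<close> is not an integer, so a load above it is at
      least \<open>W div n + 1\<close> and exceeds it by one minus its fractional part.\<close>
    have W: "?W = ?W div n * n + ?W mod n" by simp
    have "real ?W \<le> real (load h j) * real n" using False n by (simp add: norm_load_def field_simps)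
    then have "?W \<le> load h j * n" by (simp flip: of_nat_mult)
    with W r(1) have "?W div n * n < load h j * n" by linarith
    then have "?W div n < load h j" by simp
    then have "(?W div n + 1) * n \<le> load h j * n" by (intro mult_right_mono) auto
    then have "?W div n * n + n \<le> load h j * n" by (simp only: distrib_right mult_1)
    with W r(2) have "4 * ?W + n \<le> 4 * (load h j * n)" by linarith
    then have "real (4 * ?W + n) \<le> real (4 * (load h j * n))" by (simp only: of_nat_le_iff)
    then have "1 / 4 \<le> norm_load n h j" using n by (simp add: norm_load_def field_simps)
    with False show ?thesis by (simp add: deficit_def)
  qed
  have "real n / 4 = (\<Sum>j\<in>{1..n}. 1 / 4)" by simp
  also have "\<dots> \<le> (\<Sum>j\<in>{1..n}. max 0 (norm_load n h j) + deficit n h j)"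
    by (intro sum_mono pt)
  also have "\<dots> = (\<Sum>j\<in>{1..n}. max 0 (- norm_load n h j)) + (\<Sum>j\<in>{1..n}. deficit n h j)"
    by (simp only: sum.distrib sum_norm_load_pos_part[OF n])
  also have "\<dots> \<le> 2 * (\<Sum>j\<in>{1..n}. deficit n h j)"
    using sum_mono[of "{1..n}" "\<lambda>j. max 0 (- norm_load n h j)" "deficit n h", OF deficit_ge] by simp
  finally show ?thesis by simp
qed

text \<open>
  The number of \<open>v < w\<close> for which \<open>v mod n\<close> is \<open>0\<close> or at least \<open>\<lfloor>3n/4\<rfloor>\<close>.
\<close>
definition stall_count :: "nat \<Rightarrow> nat \<Rightarrow> nat" where
  "stall_count n w = w div n * (1 + (n - 3 * n div 4))
     + (if w mod n = 0 then 0 else 1 + (w mod n - 3 * n div 4))"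

lemma stall_count_0 [simp]: "stall_count n 0 = 0"
  by (simp add: stall_count_def)

text \<open>Truncated subtraction keeps the partial count at 1 until the residue passes
  \<open>3 * n div 4\<close>. At the end of a period it turns into the full count
  \<open>1 + (n - 3 * n div 4)\<close>.\<close>

lemma stall_count_Suc:
  assumes "n \<ge> 24"
  shows "stall_count n w + (if w mod n = 0 \<or> 3 * n div 4 \<le> w mod n then 1 else 0) \<le> stall_count n (Suc w)"
proof (cases "Suc (w mod n) = n")
  case True
  then have "Suc w mod n = 0" "Suc w div n = Suc (w div n)" by (simp_all add: mod_Suc div_Suc)
  with True assms show ?thesis by (auto simp: stall_count_def)
next
  case False
  then have "Suc w mod n = Suc (w mod n)" "Suc w div n = w div n" by (simp_all add: mod_Suc div_Suc)
  with assms show ?thesis by (auto simp: stall_count_def)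
qed

lemma stall_count_mono:
  assumes "n \<ge> 24" "w \<le> w'"
  shows "stall_count n w \<le> stall_count n w'"
  using assms(2)
proof (rule lift_Suc_mono_le[rotated])
  show "stall_count n k \<le> stall_count n (Suc k)" for k
    using stall_count_Suc[OF assms(1), of k] by linarith
qed

text \<open>A full period counts at most \<open>n/4 + 7/4\<close> values, which is at most
  \<open>n/3\<close> since \<open>n \<ge> 24\<close>. The additive 3 pays for residue 0 of the last,
  incomplete period.\<close>

lemma stall_count_le:
  assumes "n \<ge> 24"
  shows "3 * stall_count n w \<le> 3 + w"
proof -
  have period: "3 * (1 + (n - l)) \<le> n" and rest: "r < n \<Longrightarrow> 3 * (r - l) \<le> r"
    if "3 * n < 4 * l + 4" for l r
    using that assms by (cases "l \<le> n"; cases "l \<le> r"; simp)+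
  have l: "3 * n < 4 * (3 * n div 4) + 4" by simp
  have "w div n * (3 * (1 + (n - 3 * n div 4))) \<le> w div n * n"
    using period[OF l] by (rule mult_le_mono2)
  moreover have "3 * (if w mod n = 0 then 0 else 1 + (w mod n - 3 * n div 4)) \<le> 3 + w mod n"
    using rest[OF l, of "w mod n"] assms by simp
  moreover have "w = w div n * n + w mod n" by simp
  ultimately show ?thesis unfolding stall_count_def by (simp only: distrib_left mult.left_commute)
qed

text \<open>The process \<open>f\<close> gains \<open>9/8\<close> per round and is at most
  \<open>25/24\<close> of the total load plus \<open>1/8\<close>; clearing denominators gives 27, 3
  and 25.\<close>

lemma expected_total_load_ge:
  assumes A: "allocation_process n K" and P: "condition_P n K p" and W: "condition_W n K"
    and n: "n \<ge> 24"
  shows "27 * real m - 3 \<le> 25 * (\<integral>h. real (total_load n h) \<partial>measure_pmf (history_pmf K m))"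
proof -
  define f where "f h = real (total_load n h) + real (stall_count n (total_load n h)) / 8" for h
  have n0: "n > 0" "n \<ge> 1" using n by auto
  have f_le: "f h \<le> 25 / 24 * real (total_load n h) + 1 / 8" for h
  proof -
    have "real (3 * stall_count n (total_load n h)) \<le> real (3 + total_load n h)"
      using stall_count_le[OF n] by (simp only: of_nat_le_iff)
    then show ?thesis by (simp add: f_def)
  qed
  have bound: "\<exists>B. \<forall>h\<in>set_pmf (history_pmf K t). \<bar>f h\<bar> \<le> B" for t
  proof -
    obtain B where "\<forall>h\<in>set_pmf (history_pmf K t). real (total_load n h) \<le> B"
      using total_load_bounded[OF W A n0(1)] by blast
    then have "\<bar>f h\<bar> \<le> 25 / 24 * B + 1 / 8" if "h \<in> set_pmf (history_pmf K t)" for h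
      using f_le[of h] that by (fastforce simp: f_def)
    then show ?thesis by blast
  qed
  have drift: "f h + 9 / 8 \<le> (\<integral>r. f (h @ [r]) \<partial>measure_pmf (K h))" if h: "reachable K h" for h
  proof -
    let ?w = "total_load n h"
    note int = integrable_next_outcome[of K f, OF bound h]
    have balls: "real (total_load n (h @ [r])) = real ?w + 1 + deficit n h (fst r)"
      if "r \<in> set_pmf (K h)" for r
      using condition_W_balls[OF W A h that] by (simp add: total_load_append)
    have Suc_le: "Suc ?w \<le> total_load n (h @ [r])" if "r \<in> set_pmf (K h)" for r
      using balls[OF that] deficit_nonneg[of n h "fst r"] by linarith
    have f_ge: "f h + 1 + deficit n h (fst r) + d \<le> f (h @ [r])"
      if "r \<in> set_pmf (K h)" "real (stall_count n ?w) + 8 * d \<le> real (stall_count n (Suc ?w))" for r d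
    proof -
      have "real (stall_count n (Suc ?w)) \<le> real (stall_count n (total_load n (h @ [r])))"
        using stall_count_mono[OF n Suc_le[OF that(1)]] by simp
      with balls[OF that(1)] that(2) show ?thesis by (simp add: f_def)
    qed
    show ?thesis
    proof (cases "?w mod n = 0 \<or> 3 * n div 4 \<le> ?w mod n")
      case True
      \<comment> \<open>In a stalled round the extra \<open>1/8\<close> is certain: the total passes
        the counted value \<open>?w\<close>, and monotonicity covers any further balls.\<close>
      then have "stall_count n ?w + 1 \<le> stall_count n (Suc ?w)"
        using stall_count_Suc[OF n, of ?w] by simp
      then have st: "real (stall_count n ?w) + 8 * (1 / 8) \<le> real (stall_count n (Suc ?w))" by simp
      have "f h + 9 / 8 \<le> f (h @ [r])" if "r \<in> set_pmf (K h)" for r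
        using f_ge[OF that st] deficit_nonneg[of n h "fst r"] by linarith
      then show ?thesis by (intro measure_pmf.integral_ge_const int AE_pmfI)
    next
      case False
      \<comment> \<open>Here the extra \<open>1/8\<close> comes from the expected deficit; the stall
        count need only not decrease.\<close>
      have "real n / 8 \<le> (\<Sum>j\<in>{1..n}. deficit n h j)"
        using False by (intro sum_deficit_ge n0) auto
      then have "1 / 8 \<le> (\<Sum>i\<in>{1..n}. deficit n h i) / real n"
        using n0 by (simp add: field_simps)
      also have "\<dots> \<le> (\<integral>r. deficit n h (fst r) \<partial>measure_pmf (K h))"
        unfolding expectation_sampled_bin[OF A h] by (rule condition_P_expected_deficit[OF P h n0(2)])
      finally have "f h + 9 / 8 \<le> f h + 1 + (\<integral>r. deficit n h (fst r) \<partial>measure_pmf (K h))" by simp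
      also have "\<dots> = (\<integral>r. f h + 1 + deficit n h (fst r) \<partial>measure_pmf (K h))"
        by (simp add: integrable_sampled_bin[OF A h])
      also have "\<dots> \<le> (\<integral>r. f (h @ [r]) \<partial>measure_pmf (K h))"
      proof (intro integral_mono_AE int AE_pmfI)
        show "integrable (measure_pmf (K h)) (\<lambda>r. f h + 1 + deficit n h (fst r))"
          by (simp add: integrable_sampled_bin[OF A h])
        show "f h + 1 + deficit n h (fst r) \<le> f (h @ [r])" if "r \<in> set_pmf (K h)" for r
          using f_ge[OF that, of 0] stall_count_mono[OF n, of ?w "Suc ?w"] by simp
      qed
      finally show ?thesis .
    qed
  qed
  obtain B where B: "\<forall>h\<in>set_pmf (history_pmf K m). real (total_load n h) \<le> B"
    using total_load_bounded[OF W A n0(1)] by blast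
  have int: "integrable (measure_pmf (history_pmf K m)) (\<lambda>h. real (total_load n h))"
    using B by (intro integrable_measure_pmf_bounded[where B = B]) auto
  obtain B' where B': "\<forall>h\<in>set_pmf (history_pmf K m). \<bar>f h\<bar> \<le> B'" using bound by blast
  have "f [] + real m * (9 / 8) \<le> (\<integral>h. f h \<partial>measure_pmf (history_pmf K m))"
    by (rule expectation_drift_ge[OF bound drift])
  also have "\<dots> \<le> (\<integral>h. 25 / 24 * real (total_load n h) + 1 / 8 \<partial>measure_pmf (history_pmf K m))"
    using B' f_le int
    by (intro integral_mono_AE integrable_measure_pmf_bounded[where B = B' and f = f]) auto
  also have "\<dots> = 25 / 24 * (\<integral>h. real (total_load n h) \<partial>measure_pmf (history_pmf K m)) + 1 / 8"
    using int by simp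
  finally show ?thesis by (simp add: f_def)
qed

section \<open>Quadratic potential and the upper bound under uniform sampling\<close>

definition overload_potential :: "nat \<Rightarrow> history \<Rightarrow> real" where
  "overload_potential n h = (\<Sum>j\<in>{1..n}. (max 0 (norm_load n h j))\<^sup>2)"

lemma overload_potential_nonneg: "0 \<le> overload_potential n h"
  by (simp add: overload_potential_def sum_nonneg)

lemma overload_potential_le: "overload_potential n h \<le> real n * (real (total_load n h))\<^sup>2"
proof -
  have le: "(max 0 (norm_load n h j))\<^sup>2 \<le> (real (total_load n h))\<^sup>2" if "j \<in> {1..n}" for j
  proof (rule power_mono)
    have "load h j \<le> total_load n h"
      unfolding total_load_def using that by (intro member_le_sum) auto
    moreover have "norm_load n h j \<le> real (load h j)" by (simp add: norm_load_def)
    ultimately show "max 0 (norm_load n h j) \<le> real (total_load n h)" by simp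
  qed simp
  have "overload_potential n h \<le> (\<Sum>j\<in>{1..n}. (real (total_load n h))\<^sup>2)"
    unfolding overload_potential_def by (intro sum_mono le)
  then show ?thesis by simp
qed

text \<open>Every positive part is compared with its old value lowered by \<open>s = b / n\<close>;
  expanding these squares gives the terms in \<open>b\<close>. The received balls cost an excess
  \<open>e j\<close> in bin \<open>j\<close>, and only the sum of the excesses has to be
  controlled.\<close>

lemma overload_potential_step:
  assumes W: "condition_W n K" and A: "allocation_process n K" and n: "n > 0"
    and h: "reachable K h" and r: "r \<in> set_pmf (K h)"
  defines "b \<equiv> 1 + deficit n h (fst r)"
  shows "overload_potential n (h @ [r]) \<le> overload_potential n h
      - 2 * b / real n * (\<Sum>j\<in>{1..n}. max 0 (norm_load n h j)) + b\<^sup>2 / real n + 5 + 2 * max 0 (norm_load n h (fst r))"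
proof -
  obtain i a where ia: "r = (i, a)" by force
  have i: "i \<in> {1..n}" using A h r unfolding allocation_process_def ia by fastforce
  define s where "s = b / real n"
  let ?y = "norm_load n h"
  have s0: "0 \<le> s" using deficit_nonneg[of n h "fst r"] by (simp add: s_def b_def)
  have y': "norm_load n (h @ [r]) j = ?y j + real (a j) - s" for j
    using condition_W_balls[OF W A h r]
    by (simp add: norm_load_def load_append total_load_append s_def b_def ia add_divide_distrib)
  note W' = W[unfolded condition_W_def, rule_format, OF h r[unfolded ia], unfolded case_prod_conv Let_def]
  have shift: "(max 0 (y - s))\<^sup>2 \<le> (max 0 y - s)\<^sup>2" for y
    using s0 by (auto simp: max_def)
  obtain e where e: "\<And>j. j \<in> {1..n} \<Longrightarrow> (max 0 (?y j + real (a j) - s))\<^sup>2 \<le> (max 0 (?y j) - s)\<^sup>2 + e j"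
    and sum_e: "(\<Sum>j\<in>{1..n}. e j) \<le> 5 + 2 * max 0 (?y i)"
  proof (cases "?y i \<ge> 0")
    case True
    with W' have a: "\<And>j. j \<in> {1..n} \<Longrightarrow> a j = (if j = i then 1 else 0)" by blast
    have "(max 0 (y + 1 - s))\<^sup>2 \<le> (max 0 y - s)\<^sup>2 + (5 + 2 * max 0 y)" if "0 \<le> y" for y
    proof -
      have "(max 0 (y + 1 - s))\<^sup>2 \<le> (y + 1 - s)\<^sup>2" by (auto simp: max_def)
      also have "\<dots> = (y - s)\<^sup>2 + 2 * (y - s) + 1" by (simp add: power2_eq_square algebra_simps)
      finally show ?thesis using that s0 by simp
    qed
    \<comment> \<open>One ball costs at most \<open>1 + 2 * y\<close>; the constant is raised to 5
      so that both cases share one bound.\<close>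
    then show ?thesis using True a shift i
      by (intro that[of "\<lambda>j. if j = i then 5 + 2 * max 0 (?y i) else 0"]) auto
  next
    case False
    let ?B = "underloaded n h" and ?d = "\<lambda>j. \<lceil>- ?y j\<rceil>"
    from W' False have a0: "\<And>j. j \<in> {1..n} - ?B \<Longrightarrow> a j = 0"
      and c1: "card {j \<in> ?B. int (a j) = ?d j + 1} \<le> 1"
      and c2: "card {j \<in> ?B. int (a j) = ?d j} \<le> 1"
      and aB: "\<And>j. j \<in> ?B \<Longrightarrow> int (a j) = ?d j + 1 \<or> int (a j) = ?d j \<or> int (a j) \<le> ?d j - 1"
      by auto
    \<comment> \<open>The two exceptional bins end at height at most 2 and 1 before the shift, hence
      the squares 4 and 1; all other underloaded bins stay at or below 0.\<close>
    define e :: "nat \<Rightarrow> real" where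
      "e j = 4 * of_bool (j \<in> ?B \<and> int (a j) = ?d j + 1) + of_bool (j \<in> ?B \<and> int (a j) = ?d j)" for j
    have fin: "finite ?B" and sub: "?B \<subseteq> {1..n}" by (auto simp: underloaded_def)
    have "(\<Sum>j\<in>{1..n}. e j) = 4 * real (card {j \<in> ?B. int (a j) = ?d j + 1}) + real (card {j \<in> ?B. int (a j) = ?d j})"
    proof -
      have "{1..n} \<inter> {j. j \<in> ?B \<and> P j} = {j \<in> ?B. P j}" for P using sub by auto
      then show ?thesis
        unfolding e_def sum.distrib sum_distrib_left[symmetric] by (simp only: sum_of_bool_eq finite_atLeastAtMost)
    qed
    also have "\<dots> \<le> 5" using c1 c2 by linarith
    finally have "(\<Sum>j\<in>{1..n}. e j) \<le> 5 + 2 * max 0 (?y i)" by simp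
    moreover have "(max 0 (?y j + real (a j) - s))\<^sup>2 \<le> (max 0 (?y j) - s)\<^sup>2 + e j" if j: "j \<in> {1..n}" for j
    proof (cases "j \<in> ?B")
      case False
      then have "a j = 0" using a0 j by blast
      moreover have "0 \<le> e j" by (simp add: e_def)
      ultimately show ?thesis using shift[of "?y j"] by simp
    next
      case True
      have up: "(max 0 (?y j + real (a j) - s))\<^sup>2 \<le> c\<^sup>2" if "?y j + real (a j) \<le> c" "0 \<le> c" for c
        using that s0 by (intro power_mono) auto
      have "(max 0 (?y j + real (a j) - s))\<^sup>2 \<le> e j"
        using aB[OF True]
      proof (elim disjE)
        assume "int (a j) = ?d j + 1"
        then have "?y j + real (a j) \<le> 2" "e j = 4" using True by (auto simp: e_def) linarith
        then show ?thesis using up[of 2] by simp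
      next
        assume "int (a j) = ?d j"
        then have "?y j + real (a j) \<le> 1" "e j = 1" using True by (auto simp: e_def) linarith
        then show ?thesis using up[of 1] by simp
      next
        assume "int (a j) \<le> ?d j - 1"
        then have "?y j + real (a j) \<le> 0" "e j = 0" using True by (auto simp: e_def) linarith
        then show ?thesis using up[of 0] by simp
      qed
      then show ?thesis by (simp add: add_increasing)
    qed
    ultimately show ?thesis by (rule that[rotated])
  qed
  have "overload_potential n (h @ [r]) \<le> (\<Sum>j\<in>{1..n}. (max 0 (?y j) - s)\<^sup>2 + e j)"
    unfolding overload_potential_def y' by (intro sum_mono e)
  also have "\<dots> = (\<Sum>j\<in>{1..n}. (max 0 (?y j))\<^sup>2 - 2 * s * max 0 (?y j) + s\<^sup>2) + (\<Sum>j\<in>{1..n}. e j)"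
    unfolding sum.distrib by (simp add: power2_diff algebra_simps sum.distrib sum_subtractf)
  also have "\<dots> \<le> (\<Sum>j\<in>{1..n}. (max 0 (?y j))\<^sup>2 - 2 * s * max 0 (?y j) + s\<^sup>2) + (5 + 2 * max 0 (?y i))"
    using sum_e by simp
  also have "(\<Sum>j\<in>{1..n}. (max 0 (?y j))\<^sup>2 - 2 * s * max 0 (?y j) + s\<^sup>2)
      = overload_potential n h - 2 * s * (\<Sum>j\<in>{1..n}. max 0 (?y j)) + real n * s\<^sup>2"
    by (simp add: overload_potential_def sum.distrib sum_subtractf sum_distrib_left)
  also have "real n * s\<^sup>2 = b\<^sup>2 / real n"
    using n by (simp add: s_def power2_eq_square)
  finally show ?thesis by (simp add: s_def ia)
qed

lemma sum_power2_le_power2_sum: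
  fixes m :: "'a \<Rightarrow> real"
  assumes "finite A" "\<And>i. i \<in> A \<Longrightarrow> 0 \<le> m i"
  shows "(\<Sum>i\<in>A. (m i)\<^sup>2) \<le> (\<Sum>i\<in>A. m i)\<^sup>2"
proof -
  have "(\<Sum>i\<in>A. (m i)\<^sup>2) \<le> (\<Sum>i\<in>A. m i * (\<Sum>i\<in>A. m i))"
    unfolding power2_eq_square using assms by (intro sum_mono mult_left_mono member_le_sum) auto
  then show ?thesis by (simp add: power2_eq_square sum_distrib_right)
qed

text \<open>Each summand bounds the balls plus the change of potential when bin \<open>i\<close> is
  sampled, up to the constant 5. The sum of squared negative parts is at most
  \<open>S\<^sup>2\<close>, so the error uses up only half of the gain
  \<open>2 * S\<^sup>2 / n\<close>.\<close>

lemma uniform_average_drift: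
  fixes h :: history
  assumes n: "n > 0"
  defines "b \<equiv> \<lambda>i. 1 + deficit n h i" and "S \<equiv> \<Sum>j\<in>{1..n}. max 0 (norm_load n h j)"
  shows "(\<Sum>i\<in>{1..n}. b i - 2 * b i / real n * S + (b i)\<^sup>2 / real n + 2 * max 0 (norm_load n h i)) \<le> 13 * real n"
proof -
  define T where "T = (\<Sum>i\<in>{1..n}. deficit n h i)"
  let ?m = "\<lambda>i. max 0 (- norm_load n h i)"
  have n1: "1 \<le> real n" using n by simp
  have S: "S = (\<Sum>i\<in>{1..n}. ?m i)" unfolding S_def by (rule sum_norm_load_pos_part[OF n])
  have S0: "0 \<le> S" unfolding S_def by (intro sum_nonneg) simp
  have ST: "S \<le> T" unfolding S T_def by (intro sum_mono deficit_ge)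
  have "T \<le> (\<Sum>i\<in>{1..n}. ?m i + 1)" unfolding T_def by (intro sum_mono deficit_le)
  then have TS: "T \<le> S + real n" by (simp add: S sum.distrib)
  have "(\<Sum>i\<in>{1..n}. (b i)\<^sup>2) \<le> (\<Sum>i\<in>{1..n}. (?m i + 2)\<^sup>2)"
  proof (intro sum_mono power_mono)
    show "b i \<le> ?m i + 2" "0 \<le> b i" for i
      using deficit_le[of n h i] deficit_nonneg[of n h i] by (simp_all add: b_def)
  qed
  also have "\<dots> = (\<Sum>i\<in>{1..n}. (?m i)\<^sup>2) + 4 * S + 4 * real n"
    by (simp add: S power2_sum sum.distrib sum_distrib_left mult_ac)
  also have "\<dots> \<le> S\<^sup>2 + 4 * S + 4 * real n"
    using sum_power2_le_power2_sum[of "{1..n}" ?m] by (simp add: S)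
  finally have sq: "(\<Sum>i\<in>{1..n}. (b i)\<^sup>2) \<le> S\<^sup>2 + 4 * S + 4 * real n" .
  have sb: "(\<Sum>i\<in>{1..n}. b i) = real n + T" by (simp add: b_def T_def sum.distrib)
  have S2: "(\<Sum>i\<in>{1..n}. 2 * max 0 (norm_load n h i)) = 2 * S"
    by (simp add: S_def sum_distrib_left)
  have "(\<Sum>i\<in>{1..n}. b i - 2 * b i / real n * S + (b i)\<^sup>2 / real n + 2 * max 0 (norm_load n h i))
      = (\<Sum>i\<in>{1..n}. b i) - 2 * S / real n * (\<Sum>i\<in>{1..n}. b i) + (\<Sum>i\<in>{1..n}. (b i)\<^sup>2) / real n + 2 * S"
    unfolding sum.distrib S2 by (simp add: sum_subtractf sum_distrib_left sum_divide_distrib mult_ac)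
  also have "\<dots> \<le> (2 * real n + S) - 2 * S / real n * (real n + S) + (S\<^sup>2 + 4 * S + 4 * real n) / real n + 2 * S"
  proof -
    have "2 * S / real n * (real n + S) \<le> 2 * S / real n * (real n + T)"
      using ST S0 by (intro mult_left_mono) auto
    moreover have "(\<Sum>i\<in>{1..n}. (b i)\<^sup>2) / real n \<le> (S\<^sup>2 + 4 * S + 4 * real n) / real n"
      using sq by (rule divide_right_mono) simp
    ultimately show ?thesis unfolding sb using TS by linarith
  qed
  also have "\<dots> = 2 * real n + 4 + S + 4 * (S / real n) - S\<^sup>2 / real n"
    using n by (simp add: field_simps power2_eq_square)
  also have "\<dots> \<le> 13 * real n"
  proof -
    define x where "x = S / real n"
    have Sx: "S = x * real n" using n by (simp add: x_def)
    have x0: "0 \<le> x" using S0 by (simp add: x_def)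
    have "S\<^sup>2 / real n = x\<^sup>2 * real n" using n by (simp add: Sx power2_eq_square)
    moreover have "4 * x \<le> 4 * x * real n" using n1 x0 by (simp add: mult_le_cancel_left1)
    \<comment> \<open>With \<open>S = x * n\<close> and \<open>n \<ge> 1\<close> the sum is at most
      \<open>(6 + 5 * x - x\<^sup>2) * n\<close>. The quadratic here has negative discriminant,
      whence \<open>13 = 6 + 7\<close>.\<close>
    moreover have "0 \<le> (7 - 5 * x + x\<^sup>2) * real n"
    proof -
      have "7 - 5 * x + x\<^sup>2 = (x - 5/2)\<^sup>2 + 3/4" by (simp add: power2_eq_square algebra_simps)
      then show ?thesis by simp
    qed
    ultimately show ?thesis using n1 by (simp add: Sx algebra_simps x_def[symmetric])
  qed
  finally show ?thesis .
qed

text \<open>The potential is nonnegative and starts at 0, so a drift bound on its sum with the total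
  load bounds the total load itself. The constant is 18 = 5 + 13: filling cost plus averaged
  drift.\<close>

lemma expected_total_load_le:
  assumes A: "allocation_process n K" and P: "condition_P n K p" and W: "condition_W n K"
    and U: "uniform_sampling n K p" and n: "n > 0"
  shows "(\<integral>h. real (total_load n h) \<partial>measure_pmf (history_pmf K m)) \<le> 18 * real m"
proof -
  define f where "f h = overload_potential n h + real (total_load n h)" for h
  have f_ge: "real (total_load n h) \<le> f h" for h
    using overload_potential_nonneg[of n h] by (simp add: f_def)
  have bound: "\<exists>B. \<forall>h\<in>set_pmf (history_pmf K t). \<bar>f h\<bar> \<le> B" for t
  proof -
    obtain B where B: "B \<ge> 0" "\<forall>h\<in>set_pmf (history_pmf K t). real (total_load n h) \<le> B"
      using total_load_bounded[OF W A n] by blast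
    have "\<bar>f h\<bar> \<le> real n * B\<^sup>2 + B" if h: "h \<in> set_pmf (history_pmf K t)" for h
    proof -
      have "real n * (real (total_load n h))\<^sup>2 \<le> real n * B\<^sup>2"
        using B h by (intro mult_left_mono power_mono) auto
      then show ?thesis
        using overload_potential_nonneg[of n h] overload_potential_le[of n h] B h
        by (simp add: f_def) fastforce
    qed
    then show ?thesis by blast
  qed
  have drift: "(\<integral>r. f (h @ [r]) \<partial>measure_pmf (K h)) \<le> f h + 18" if h: "reachable K h" for h
  proof -
    let ?S = "\<Sum>j\<in>{1..n}. max 0 (norm_load n h j)"
    define b where "b i = 1 + deficit n h i" for i
    define u where "u i = b i - 2 * b i / real n * ?S + (b i)\<^sup>2 / real n + 2 * max 0 (norm_load n h i)" for i
    have "f (h @ [r]) \<le> f h + 5 + u (fst r)" if "r \<in> set_pmf (K h)" for r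
      using overload_potential_step[OF W A n h that] condition_W_balls[OF W A h that]
      by (simp add: f_def u_def b_def total_load_append)
    then have "(\<integral>r. f (h @ [r]) \<partial>measure_pmf (K h)) \<le> (\<integral>r. f h + 5 + u (fst r) \<partial>measure_pmf (K h))"
      using integrable_sampled_bin[OF A h, of u]
      by (intro integral_mono_AE integrable_next_outcome[of K f, OF bound h] AE_pmfI) auto
    also have "\<dots> = f h + 5 + (\<Sum>i\<in>{1..n}. pmf (map_pmf fst (K h)) i * u i)"
      by (simp add: integrable_sampled_bin[OF A h]
            expectation_sampled_bin[OF A h])
    also have "(\<Sum>i\<in>{1..n}. pmf (map_pmf fst (K h)) i * u i) = (\<Sum>i\<in>{1..n}. u i) / real n"
      by (simp add: uniform_sampling_pmf[OF P U h] sum_divide_distrib)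
    also have "\<dots> \<le> 13"
      using uniform_average_drift[OF n, of h] n by (simp add: u_def b_def field_simps)
    finally show ?thesis by simp
  qed
  obtain B where B: "\<forall>h\<in>set_pmf (history_pmf K m). \<bar>f h\<bar> \<le> B" using bound by blast
  have "(\<integral>h. real (total_load n h) \<partial>measure_pmf (history_pmf K m)) \<le> (\<integral>h. f h \<partial>measure_pmf (history_pmf K m))"
  proof (intro integral_mono_AE integrable_measure_pmf_bounded[where B = B] AE_pmfI)
    show "\<bar>real (total_load n h)\<bar> \<le> B" "\<bar>f h\<bar> \<le> B" if "h \<in> set_pmf (history_pmf K m)" for h
      using B f_ge[of h] that by fastforce+
  qed (rule f_ge)
  also have "\<dots> \<le> f [] + real m * 18"
    by (rule expectation_drift_le[OF bound drift])
  finally show ?thesis by (simp add: f_def overload_potential_def)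
qed

theorem theorem3p2:
  "\<exists>c C :: real. c > 0 \<and> C > 0 \<and>
     (\<forall>\<^sub>F n in sequentially. \<forall>K p.
        allocation_process n K \<and> condition_P n K p \<and> condition_W n K \<longrightarrow>
          (\<forall>m\<ge>2. expected_throughput n K m \<ge> 1 + c) \<and>
          (uniform_sampling n K p \<longrightarrow>
             (\<forall>m\<ge>2. 1 + c \<le> expected_throughput n K m \<and> expected_throughput n K m \<le> C)))"
proof -
  \<comment> \<open>The bound \<open>(27 * m - 3) / (25 * m)\<close> increases with \<open>m\<close>
    and equals \<open>1 + 1 / 50\<close> at \<open>m = 2\<close>.\<close>
  have lower: "1 + 1 / 50 \<le> expected_throughput n K m"
    if "n \<ge> 24" "allocation_process n K" "condition_P n K p" "condition_W n K" "m \<ge> 2" for n K p m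
    using expected_total_load_ge[OF that(2,3,4,1), of m] that(5)
    by (simp add: expected_throughput_def field_simps)
  have upper: "expected_throughput n K m \<le> 18"
    if "n \<ge> 24" "allocation_process n K" "condition_P n K p" "condition_W n K"
      "uniform_sampling n K p" "m \<ge> 2" for n K p m
    using expected_total_load_le[OF that(2,3,4,5), of m] that(1,6)
    by (simp add: expected_throughput_def field_simps)
  have "\<forall>\<^sub>F n in sequentially. \<forall>K p.
      allocation_process n K \<and> condition_P n K p \<and> condition_W n K \<longrightarrow>
        (\<forall>m\<ge>2. expected_throughput n K m \<ge> 1 + 1 / 50) \<and>
        (uniform_sampling n K p \<longrightarrow>
           (\<forall>m\<ge>2. 1 + 1 / 50 \<le> expected_throughput n K m \<and> expected_throughput n K m \<le> 18))"
    by (rule eventually_sequentiallyI[of 24]) (blast intro: lower upper)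
  then show ?thesis
    by (intro exI[of _ "1 / 50"] exI[of _ 18] conjI) simp_all
qed

end
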